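(* Let $B_d\in\mathbb C^{d,d}$ have all eigenvalues in $\mathbb D=\{z\in\mathbb C:|z|<1\}$ and let $\rho<1$ be its spectral radius, i.e., the largest modulus of an eigenvalue of $B_d$. (i) If every eigenvalue with modulus $\rho$ is semi-simple, then there exists $X=X^*>0$ such that $$\rho^2X-B_d^*XB_d\ge0,$$ and the inequality is not strict, i.e., there exists a nonzero vector $z\in\mathbb C^d$ such that $z^*(\rho^2X-B_d^*XB_d)z=0$. (ii) If at least one eigenvalue $\lambda$ with modulus $\rho$ is defective, i.e., there exists a Jordan block of size larger than one associated with $\lambda$, then for every $\epsilon>0$ there exists $X=X^*>0$ such that $$(\rho^2+\epsilon)X-B_d^*XB_d\ge0.$$
   Context: $\mathbb C^{d,d}$ denotes complex $d\times d$ matrices ($d\ge1$), $^*$ the conjugate transpose. $X=X^*>0$ means $X$ is Hermitian positive definite; $\ge0$ means positive semidefinite. An eigenvalue is semi-simple if all its Jordan blocks have size one. *)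

theory Defs
  imports Jordan_Normal_Form.Spectral_Radius Jordan_Normal_Form.Schur_Decomposition
begin

definition hermitian_mat :: "complex mat \<Rightarrow> bool" where
  "hermitian_mat A \<longleftrightarrow> mat_adjoint A = A"

text \<open>The form \<open>z\<^sup>* A z\<close>.  The sesquilinear product \<open>u \<bullet>c v\<close> is conjugate linear in its second
  argument, so \<open>z\<^sup>* (A z)\<close> is \<open>(A z) \<bullet>c z\<close>.\<close>

definition quad_form :: "complex mat \<Rightarrow> complex vec \<Rightarrow> complex" where
  "quad_form A z = (A *\<^sub>v z) \<bullet>c z"

text \<open>On complex numbers \<open>0 < w\<close> and \<open>0 \<le> w\<close> include that \<open>w\<close> is real.\<close>

definition pos_def_mat :: "complex mat \<Rightarrow> bool" where
  "pos_def_mat A \<longleftrightarrow> hermitian_mat A \<and>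
     (\<forall>z \<in> carrier_vec (dim_row A). z \<noteq> 0\<^sub>v (dim_row A) \<longrightarrow> 0 < quad_form A z)"

definition pos_semidef_mat :: "complex mat \<Rightarrow> bool" where
  "pos_semidef_mat A \<longleftrightarrow> hermitian_mat A \<and>
     (\<forall>z \<in> carrier_vec (dim_row A). 0 \<le> quad_form A z)"

text \<open>The Jordan normal form of a complex square matrix exists and is unique up to the order of
  the blocks, so the choice of \<open>n_as\<close> below is immaterial.\<close>

definition has_jordan_block :: "complex mat \<Rightarrow> nat \<Rightarrow> complex \<Rightarrow> bool" where
  "has_jordan_block A n \<mu> \<longleftrightarrow> (\<exists>n_as. jordan_nf A n_as \<and> (n, \<mu>) \<in> set n_as)"

definition semisimple_eigenvalue :: "complex mat \<Rightarrow> complex \<Rightarrow> bool" where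
  "semisimple_eigenvalue A \<mu> \<longleftrightarrow> eigenvalue A \<mu> \<and> (\<forall>n. has_jordan_block A n \<mu> \<longrightarrow> n = 1)"

definition defective_eigenvalue :: "complex mat \<Rightarrow> complex \<Rightarrow> bool" where
  "defective_eigenvalue A \<mu> \<longleftrightarrow> eigenvalue A \<mu> \<and> (\<exists>n > 1. has_jordan_block A n \<mu>)"

end

theory Submission
  imports Defs
begin

text \<open>
  An inequality \<open>r X - B\<^sup>* X B \<ge> 0\<close> with \<open>X = M\<^sup>* M\<close> says that \<open>B\<close> expands the norm
  \<open>z \<mapsto> \<bar>M z\<bar>\<close> by a factor of at most \<open>\<surd>r\<close>, so a norm adapted to \<open>B\<close> is needed.  If \<open>B\<close> is
  \<open>J\<close> in a Jordan basis, the Euclidean norm of the coordinates is nearly right: on a block with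
  eigenvalue \<open>a\<close>, \<open>J\<close> is multiplication by \<open>a\<close> plus a shift.  Rescaling the \<open>i\<close>-th coordinate by
  \<open>(1/\<delta>)\<^sup>i\<close> multiplies the shift by \<open>\<delta>\<close>, and the squared norm then grows by a factor of at most
  \<open>(1 + \<delta>) \<bar>a\<bar>\<^sup>2 + \<delta>\<^sup>2 + \<delta>\<close> (lemma \<open>bidiagonal_contraction\<close>).  For small \<open>\<delta>\<close> this is at most
  \<open>r\<close> as soon as \<open>\<bar>a\<bar>\<^sup>2 < r\<close>.  A block of size one has no shift, and there \<open>\<bar>a\<bar>\<^sup>2 \<le> r\<close> suffices.
  This is lemma \<open>jordan_nf_Stein\<close>.

  Both parts of the theorem are instances of it.  With \<open>r = \<rho>\<^sup>2\<close>, semi-simplicity says exactly that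
  blocks of size larger than one belong to eigenvalues of modulus less than \<open>\<rho>\<close>; with
  \<open>r = \<rho>\<^sup>2 + \<epsilon>\<close>, all eigenvalues satisfy the strict bound.  The inequality for \<open>r = \<rho>\<^sup>2\<close> cannot
  be strict for any \<open>X\<close>: an eigenvector for an eigenvalue of modulus \<open>\<rho>\<close> makes the form vanish
  (lemma \<open>Stein_form_eigenvector\<close>).
\<close>

section \<open>Adjoints and quadratic forms\<close>

lemma mat_adjoint_carrier:
  fixes A :: "complex mat"
  assumes "A \<in> carrier_mat n m"
  shows "mat_adjoint A \<in> carrier_mat m n"
  using assms by (auto simp: mat_adjoint_def mat_of_rows_def)

lemma mat_adjoint_index:
  fixes A :: "complex mat"
  assumes "i < dim_col A" "j < dim_row A"
  shows "mat_adjoint A $$ (i, j) = cnj (A $$ (j, i))"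
  using assms by (simp add: mat_adjoint_def mat_of_rows_def)

lemma mat_adjoint_cscalar_prod:
  fixes A :: "complex mat"
  assumes A: "A \<in> carrier_mat n m" and u: "u \<in> carrier_vec n" and v: "v \<in> carrier_vec m"
  shows "(mat_adjoint A *\<^sub>v u) \<bullet>c v = u \<bullet>c (A *\<^sub>v v)"
proof -
  have c: "mat_adjoint A \<in> carrier_mat m n" using mat_adjoint_carrier[OF A] .
  have "(mat_adjoint A *\<^sub>v u) \<bullet>c v = (\<Sum>j<m. (\<Sum>i<n. cnj (A $$ (i,j)) * u $ i) * cnj (v $ j))"
    using A u v c
    by (auto simp: scalar_prod_def mat_adjoint_index lessThan_atLeast0 intro!: sum.cong)
  also have "\<dots> = (\<Sum>i<n. u $ i * cnj (\<Sum>j<m. A $$ (i,j) * v $ j))"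
    unfolding cnj_sum sum_distrib_left sum_distrib_right
    by (subst sum.swap) (simp add: mult_ac)
  also have "\<dots> = u \<bullet>c (A *\<^sub>v v)"
    using A u v by (auto simp: scalar_prod_def lessThan_atLeast0 intro!: sum.cong)
  finally show ?thesis .
qed

lemma mat_adjoint_mult:
  fixes A B :: "complex mat"
  assumes A: "A \<in> carrier_mat n m" and B: "B \<in> carrier_mat m k"
  shows "mat_adjoint (A * B) = mat_adjoint B * mat_adjoint A"
proof -
  note c = mat_adjoint_carrier[OF A] mat_adjoint_carrier[OF B]
    mat_adjoint_carrier[OF mult_carrier_mat[OF A B]]
  show ?thesis
    by (rule eq_matI)
      (use A B c in \<open>auto simp: mat_adjoint_index scalar_prod_def mult.commute intro!: sum.cong\<close>)
qed

lemma mat_adjoint_mat_adjoint: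
  fixes A :: "complex mat"
  assumes A: "A \<in> carrier_mat n m"
  shows "mat_adjoint (mat_adjoint A) = A"
proof -
  note c = mat_adjoint_carrier[OF A] mat_adjoint_carrier[OF mat_adjoint_carrier[OF A]]
  show ?thesis
    by (rule eq_matI) (use A c in \<open>auto simp: mat_adjoint_index\<close>)
qed

lemma cscalar_prod_self:
  fixes v :: "complex vec"
  shows "v \<bullet>c v = complex_of_real (\<Sum>i<dim_vec v. (cmod (v $ i))\<^sup>2)"
  by (simp add: scalar_prod_def lessThan_atLeast0 complex_norm_square del: of_real_power)

lemma quad_form_Gram:
  fixes M :: "complex mat"
  assumes M: "M \<in> carrier_mat n d" and z: "z \<in> carrier_vec d"
  shows "quad_form (mat_adjoint M * M) z
    = complex_of_real (\<Sum>i<n. (cmod ((M *\<^sub>v z) $ i))\<^sup>2)"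
proof -
  have "quad_form (mat_adjoint M * M) z = (mat_adjoint M *\<^sub>v (M *\<^sub>v z)) \<bullet>c z"
    unfolding quad_form_def
    by (subst assoc_mult_mat_vec[OF mat_adjoint_carrier[OF M] M z]) simp
  also have "\<dots> = (M *\<^sub>v z) \<bullet>c (M *\<^sub>v z)"
    by (rule mat_adjoint_cscalar_prod[OF M]) (use M z in auto)
  finally show ?thesis using M by (simp add: cscalar_prod_self)
qed

lemma hermitian_Gram:
  fixes M :: "complex mat"
  assumes M: "M \<in> carrier_mat n d"
  shows "hermitian_mat (mat_adjoint M * M)"
  unfolding hermitian_mat_def
  by (simp add: mat_adjoint_mult[OF mat_adjoint_carrier[OF M] M] mat_adjoint_mat_adjoint[OF M])

lemma hermitian_Stein:
  fixes X B :: "complex mat"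
  assumes X: "X \<in> carrier_mat d d" and B: "B \<in> carrier_mat d d" and h: "hermitian_mat X"
  shows "hermitian_mat (complex_of_real r \<cdot>\<^sub>m X - mat_adjoint B * X * B)"
proof -
  define C where "C = mat_adjoint B * X * B"
  note aB = mat_adjoint_carrier[OF B]
  have C: "C \<in> carrier_mat d d" unfolding C_def using aB X B by auto
  have "mat_adjoint C = mat_adjoint B * (mat_adjoint X * mat_adjoint (mat_adjoint B))"
    unfolding C_def
    by (simp add: mat_adjoint_mult[OF mult_carrier_mat[OF aB X] B] mat_adjoint_mult[OF aB X])
  also have "\<dots> = C"
    using h unfolding C_def hermitian_mat_def
    by (simp add: mat_adjoint_mat_adjoint[OF B] assoc_mult_mat[OF aB X B])
  finally have hC: "mat_adjoint C = C" .
  have cX: "cnj (X $$ (j, i)) = X $$ (i, j)" if "i < d" "j < d" for i j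
    using mat_adjoint_index[of i X j] X h that by (auto simp: hermitian_mat_def)
  have cC: "cnj (C $$ (j, i)) = C $$ (i, j)" if "i < d" "j < d" for i j
    using mat_adjoint_index[of i C j] C hC that by auto
  have D: "complex_of_real r \<cdot>\<^sub>m X - C \<in> carrier_mat d d" using X C by auto
  show ?thesis
    unfolding hermitian_mat_def C_def[symmetric]
    by (rule eq_matI)
      (use mat_adjoint_carrier[OF D] D X C cX cC in \<open>auto simp: mat_adjoint_index\<close>)
qed

text \<open>Adjointness moves \<open>B\<^sup>*\<close> to the other argument, so that the matrix inequality becomes a
  comparison of the form of \<open>X\<close> at \<open>z\<close> and at \<open>B z\<close>.\<close>

lemma quad_form_Stein:
  fixes X B :: "complex mat"
  assumes X: "X \<in> carrier_mat d d" and B: "B \<in> carrier_mat d d" and z: "z \<in> carrier_vec d"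
  shows "quad_form (c \<cdot>\<^sub>m X - mat_adjoint B * X * B) z
    = c * quad_form X z - quad_form X (B *\<^sub>v z)"
proof -
  note aB = mat_adjoint_carrier[OF B]
  have Bz: "B *\<^sub>v z \<in> carrier_vec d" using B z by auto
  have smult: "(c \<cdot>\<^sub>m X) *\<^sub>v z = c \<cdot>\<^sub>v (X *\<^sub>v z)"
    using X z by (intro eq_vecI) auto
  have "(c \<cdot>\<^sub>m X - mat_adjoint B * X * B) *\<^sub>v z
      = c \<cdot>\<^sub>v (X *\<^sub>v z) - mat_adjoint B *\<^sub>v (X *\<^sub>v (B *\<^sub>v z))"
    using aB X B z Bz
    by (simp add: minus_mult_distrib_mat_vec[of _ d d] assoc_mult_mat_vec[of _ d d _ d] smult)
  then have "quad_form (c \<cdot>\<^sub>m X - mat_adjoint B * X * B) z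
      = c * quad_form X z - (mat_adjoint B *\<^sub>v (X *\<^sub>v (B *\<^sub>v z))) \<bullet>c z"
    unfolding quad_form_def using aB X z Bz
    by (simp add: minus_scalar_prod_distrib[of _ d])
  then show ?thesis
    unfolding quad_form_def
    using mat_adjoint_cscalar_prod[OF B _ z, of "X *\<^sub>v (B *\<^sub>v z)"] X Bz by simp
qed

lemma quad_form_smult_vec:
  fixes X :: "complex mat"
  assumes X: "X \<in> carrier_mat d d" and z: "z \<in> carrier_vec d"
  shows "quad_form X (c \<cdot>\<^sub>v z) = complex_of_real ((cmod c)\<^sup>2) * quad_form X z"
  unfolding quad_form_def using X z
  by (simp add: mult_mat_vec[of _ d d] conjugate_smult_vec complex_norm_square del: of_real_power)

section \<open>Jordan matrices and their rescaling\<close>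

text \<open>A nonzero entry above the diagonal lies inside a single block, which therefore has size
  larger than one and the same eigenvalue in the rows \<open>i\<close> and \<open>i + 1\<close>.  The three properties
  are all that the norm estimate needs, and they let it work with global row indices instead of
  blocks.\<close>

lemma jordan_matrix_entries:
  fixes n_as :: "(nat \<times> 'a :: {zero,one}) list"
  assumes "i < sum_list (map fst n_as)" "j < sum_list (map fst n_as)"
  shows "(\<exists>n. (n, jordan_matrix n_as $$ (i, i)) \<in> set n_as)
    \<and> (j \<noteq> i \<and> j \<noteq> Suc i \<longrightarrow> jordan_matrix n_as $$ (i, j) = 0)
    \<and> (j = Suc i \<and> jordan_matrix n_as $$ (i, j) \<noteq> 0 \<longrightarrow>
        jordan_matrix n_as $$ (i, j) = 1
        \<and> jordan_matrix n_as $$ (j, j) = jordan_matrix n_as $$ (i, i)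
        \<and> (\<exists>n>1. (n, jordan_matrix n_as $$ (i, i)) \<in> set n_as))"
  using assms
proof (induction n_as arbitrary: i j)
  case Nil
  then show ?case by simp
next
  case (Cons na n_as)
  obtain n a where na: "na = (n, a)" by force
  define N where "N = sum_list (map fst n_as)"
  define J where "J = jordan_matrix n_as"
  have dimJ: "dim_row J = N" "dim_col J = N" unfolding J_def N_def by simp_all
  have ent: "jordan_matrix (na # n_as) $$ (k, l) =
      (if k < n then if l < n then jordan_block n a $$ (k, l) else 0
       else if l < n then 0 else J $$ (k - n, l - n))"
    if "k < n + N" "l < n + N" for k l
    using that unfolding na jordan_matrix_Cons
    by (auto simp: N_def[symmetric] J_def[symmetric] dimJ)
  have ij: "i < n + N" "j < n + N" using Cons.prems by (simp_all add: na N_def)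
  show ?case
  proof (cases "i < n")
    case True
    then show ?thesis using ij
      by (auto simp: ent) (auto simp: na intro!: exI[of _ n])
  next
    case False
    then have i': "i - n < N" using ij by simp
    show ?thesis
    proof (cases "j < n")
      case True
      then show ?thesis using ij False Cons.IH[of "i - n" "i - n"] i'
        by (auto simp: ent N_def[symmetric] J_def[symmetric])
    next
      case jn: False
      then have j': "j - n < N" using ij by simp
      have eq: "j - n = i - n \<longleftrightarrow> j = i" "j - n = Suc (i - n) \<longleftrightarrow> j = Suc i"
        using False jn by auto
      show ?thesis using ij False jn Cons.IH[of "i - n" "j - n"] i' j'
        unfolding eq N_def[symmetric] J_def[symmetric]
        by (auto simp: ent)
    qed
  qed
qed

text \<open>The matrix has diagonal \<open>l\<close> and entries \<open>\<delta>\<close> above the diagonal in the rows \<open>S\<close>.  By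
  Young's inequality row \<open>i \<in> S\<close> contributes at most
  \<open>(1 + \<delta>) \<bar>l\<^sub>i\<bar>\<^sup>2 \<bar>u\<^sub>i\<bar>\<^sup>2 + (\<delta>\<^sup>2 + \<delta>) \<bar>u\<^sub>i\<^sub>+\<^sub>1\<bar>\<^sup>2\<close>.  Collecting the coefficients of one
  \<open>\<bar>u\<^sub>i\<bar>\<^sup>2\<close>, which receives the first term from its own row and the second from the row before,
  gives a factor of at most \<open>r\<close>; here it matters that coupled rows have the same diagonal
  entry, since \<open>i\<close> need not be in \<open>S\<close> when \<open>i - 1\<close> is.\<close>

lemma bidiagonal_contraction:
  fixes l u :: "nat \<Rightarrow> complex" and S :: "nat set" and \<delta> r :: real
  assumes \<delta>: "\<delta> > 0"
    and diag: "\<And>i. i < d \<Longrightarrow> (cmod (l i))\<^sup>2 \<le> r"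
    and S: "\<And>i. i \<in> S \<Longrightarrow> Suc i < d \<and> l (Suc i) = l i
              \<and> (1 + \<delta>) * (cmod (l i))\<^sup>2 + (\<delta>\<^sup>2 + \<delta>) \<le> r"
  shows "(\<Sum>i<d. (cmod (l i * u i + (if i \<in> S then complex_of_real \<delta> * u (Suc i) else 0)))\<^sup>2)
    \<le> r * (\<Sum>i<d. (cmod (u i))\<^sup>2)"
proof -
  \<comment> \<open>\<open>p i\<close> and \<open>q i\<close> are the contributions to \<open>\<bar>u\<^sub>i\<bar>\<^sup>2\<close> from row \<open>i\<close> and from row \<open>i - 1\<close>.\<close>
  define p where "p i = (if i \<in> S then 1 + \<delta> else 1) * (cmod (l i))\<^sup>2 * (cmod (u i))\<^sup>2" for i
  define q where "q k = (if k \<in> Suc ` S then (\<delta>\<^sup>2 + \<delta>) * (cmod (u k))\<^sup>2 else 0)" for k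
  have "(cmod (l i * u i + (if i \<in> S then complex_of_real \<delta> * u (Suc i) else 0)))\<^sup>2
      \<le> p i + q (Suc i)" for i
  proof (cases "i \<in> S")
    case True
    define x where "x = cmod (l i * u i)"
    define y where "y = cmod (u (Suc i))"
    have "cmod (l i * u i + complex_of_real \<delta> * u (Suc i)) \<le> x + \<delta> * y"
      using norm_triangle_ineq[of "l i * u i" "complex_of_real \<delta> * u (Suc i)"] \<delta>
      by (simp add: x_def y_def norm_mult)
    then have "(cmod (l i * u i + complex_of_real \<delta> * u (Suc i)))\<^sup>2 \<le> (x + \<delta> * y)\<^sup>2"
      by (intro power_mono) auto
    \<comment> \<open>the mixed term is split as \<open>2 x y \<le> x\<^sup>2 + y\<^sup>2\<close>\<close>
    also have "\<dots> = x\<^sup>2 + \<delta> * (2 * x * y) + \<delta>\<^sup>2 * y\<^sup>2"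
      by (simp add: power2_eq_square algebra_simps)
    also have "\<dots> \<le> x\<^sup>2 + \<delta> * (x\<^sup>2 + y\<^sup>2) + \<delta>\<^sup>2 * y\<^sup>2"
      using \<delta> sum_squares_bound[of x y] by simp
    also have "\<dots> = p i + q (Suc i)"
      using True
      by (simp add: p_def q_def x_def y_def norm_mult power_mult_distrib algebra_simps)
    finally show ?thesis using True by simp
  next
    case False
    have "0 \<le> q (Suc i)" using \<delta> by (simp add: q_def)
    then show ?thesis using False by (simp add: p_def norm_mult power_mult_distrib)
  qed
  then have "(\<Sum>i<d. (cmod (l i * u i + (if i \<in> S then complex_of_real \<delta> * u (Suc i) else 0)))\<^sup>2)
      \<le> (\<Sum>i<d. p i + q (Suc i))"
    by (intro sum_mono)
  also have "\<dots> = (\<Sum>i<d. p i) + (\<Sum>i<d. q (Suc i))" by (rule sum.distrib)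
  also have "(\<Sum>i<d. q (Suc i)) = (\<Sum>i<d. q i)"
  proof -
    \<comment> \<open>the shifted sum loses \<open>q 0\<close> and gains \<open>q d\<close>; no row lies above the first, and none in \<open>S\<close> is the last\<close>
    have "q 0 = 0" "q d = 0" using S by (auto simp: q_def)
    then show ?thesis using sum.lessThan_Suc_shift[of q d] by simp
  qed
  also have "(\<Sum>i<d. p i) + (\<Sum>i<d. q i) = (\<Sum>i<d. p i + q i)" by (rule sum.distrib[symmetric])
  also have "\<dots> \<le> (\<Sum>i<d. r * (cmod (u i))\<^sup>2)"
  proof (rule sum_mono)
    fix i assume "i \<in> {..<d}"
    then have d: "(cmod (l i))\<^sup>2 \<le> r" using diag by simp
    define s where "s = (if i \<in> S then 1 + \<delta> else 1) * (cmod (l i))\<^sup>2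
      + (if i \<in> Suc ` S then \<delta>\<^sup>2 + \<delta> else 0)"
    have "s \<le> r"
    proof (cases "i \<in> S \<or> i \<in> Suc ` S")
      case True
      then have *: "(1 + \<delta>) * (cmod (l i))\<^sup>2 + (\<delta>\<^sup>2 + \<delta>) \<le> r" using S by auto
      have "s \<le> (1 + \<delta>) * (cmod (l i))\<^sup>2 + (\<delta>\<^sup>2 + \<delta>)"
        unfolding s_def using \<delta> by (intro add_mono mult_right_mono) auto
      with * show ?thesis by linarith
    next
      case False
      then show ?thesis using d by (simp add: s_def)
    qed
    moreover have "p i + q i = s * (cmod (u i))\<^sup>2"
      by (simp add: p_def q_def s_def algebra_simps)
    ultimately show "p i + q i \<le> r * (cmod (u i))\<^sup>2"
      by (simp add: mult_right_mono)
  qed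
  finally show ?thesis by (simp add: sum_distrib_left)
qed

text \<open>As \<open>\<delta>\<close> tends to 0 from the right, the left-hand side tends to \<open>\<bar>a\<bar>\<^sup>2 < r\<close>, and finitely
  many such conditions can be met at once.\<close>

lemma small_coupling_exists:
  fixes F :: "(nat \<times> complex) set" and r :: real
  assumes "finite F" and "\<And>n a. (n, a) \<in> F \<Longrightarrow> n > 1 \<Longrightarrow> (cmod a)\<^sup>2 < r"
  shows "\<exists>\<delta>>0. \<forall>n a. (n, a) \<in> F \<longrightarrow> n > 1 \<longrightarrow> (1 + \<delta>) * (cmod a)\<^sup>2 + (\<delta>\<^sup>2 + \<delta>) \<le> r"
proof -
  have "\<forall>\<^sub>F \<delta> in at_right 0. case x of (n, a) \<Rightarrow>
      n > 1 \<longrightarrow> (1 + \<delta>) * (cmod a)\<^sup>2 + (\<delta>\<^sup>2 + \<delta>) \<le> r" if "x \<in> F" for x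
  proof (cases x)
    case (Pair n a)
    show ?thesis
    proof (cases "n > 1")
      case True
      have "((\<lambda>\<delta>. (1 + \<delta>) * (cmod a)\<^sup>2 + (\<delta>\<^sup>2 + \<delta>)) \<longlongrightarrow>
          (1 + 0) * (cmod a)\<^sup>2 + (0\<^sup>2 + 0)) (at_right (0::real))"
        by (intro tendsto_intros)
      then have "\<forall>\<^sub>F \<delta> in at_right 0. (1 + \<delta>) * (cmod a)\<^sup>2 + (\<delta>\<^sup>2 + \<delta>) < r"
        by (rule order_tendstoD) (use assms(2)[of n a] that Pair True in simp)
      then show ?thesis by eventually_elim (simp add: Pair)
    qed (simp add: Pair)
  qed
  with assms(1) have "\<forall>\<^sub>F \<delta> in at_right 0. \<forall>x\<in>F. case x of (n, a) \<Rightarrow>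
      n > 1 \<longrightarrow> (1 + \<delta>) * (cmod a)\<^sup>2 + (\<delta>\<^sup>2 + \<delta>) \<le> r"
    by (simp add: eventually_ball_finite)
  then have "\<forall>\<^sub>F \<delta> in at_right (0::real). \<delta> > 0 \<and> (\<forall>x\<in>F. case x of (n, a) \<Rightarrow>
      n > 1 \<longrightarrow> (1 + \<delta>) * (cmod a)\<^sup>2 + (\<delta>\<^sup>2 + \<delta>) \<le> r)"
    by (intro eventually_conj eventually_at_right_less)
  then obtain \<delta> where "\<delta> > 0" "\<forall>x\<in>F. case x of (n, a) \<Rightarrow>
      n > 1 \<longrightarrow> (1 + \<delta>) * (cmod a)\<^sup>2 + (\<delta>\<^sup>2 + \<delta>) \<le> r"
    using eventually_happens'[OF trivial_limit_at_right_real] by blast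
  then show ?thesis by fastforce
qed

section \<open>Solving the Stein inequality\<close>

text \<open>The matrix \<open>X\<close> is \<open>M\<^sup>* M\<close>, where \<open>M\<close> maps \<open>z\<close> to its rescaled coordinates in a Jordan
  basis of \<open>B\<close>.  It is definite because \<open>M\<close> is injective, and \<open>B\<close> acts on the
  rescaled coordinates by the matrix of \<open>bidiagonal_contraction\<close>.\<close>

lemma jordan_nf_Stein:
  fixes B :: "complex mat" and r :: real
  assumes B: "B \<in> carrier_mat d d" and jnf: "jordan_nf B n_as"
    and le: "\<And>n a. (n, a) \<in> set n_as \<Longrightarrow> (cmod a)\<^sup>2 \<le> r"
    and less: "\<And>n a. (n, a) \<in> set n_as \<Longrightarrow> n > 1 \<Longrightarrow> (cmod a)\<^sup>2 < r"
  shows "\<exists>X \<in> carrier_mat d d. pos_def_mat X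
    \<and> pos_semidef_mat (complex_of_real r \<cdot>\<^sub>m X - mat_adjoint B * X * B)"
proof -
  define J where "J = jordan_matrix n_as"
  obtain P Y where wit: "similar_mat_wit B J P Y"
    using jnf unfolding jordan_nf_def similar_mat_def J_def by auto
  have d: "d = dim_row B" using B by simp
  note w = similar_mat_witD[OF d wit]
  have P: "P \<in> carrier_mat d d" and Y: "Y \<in> carrier_mat d d" and J: "J \<in> carrier_mat d d"
    and PY: "P * Y = 1\<^sub>m d" and YP: "Y * P = 1\<^sub>m d" and BPJY: "B = P * J * Y"
    using w by auto
  have N: "sum_list (map fst n_as) = d" using J unfolding J_def by auto
  note Jent = jordan_matrix_entries[of _ n_as, unfolded N, folded J_def]
  obtain \<delta> where \<delta>: "\<delta> > 0"
    and small: "\<And>n a. (n, a) \<in> set n_as \<Longrightarrow> n > 1 \<Longrightarrow>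
        (1 + \<delta>) * (cmod a)\<^sup>2 + (\<delta>\<^sup>2 + \<delta>) \<le> r"
    using small_coupling_exists[of "set n_as" r] less by blast
  define S where "S = {i. Suc i < d \<and> J $$ (i, Suc i) \<noteq> 0}"
  have YBz: "Y *\<^sub>v (B *\<^sub>v z) = J *\<^sub>v (Y *\<^sub>v z)" if z: "z \<in> carrier_vec d" for z
  proof -
    have "Y * B = Y * P * (J * Y)" unfolding BPJY using P J Y
      by (simp add: assoc_mult_mat[of _ d d _ d _ d])
    then have "Y * B = J * Y" using YP J Y by simp
    then show ?thesis
      using assoc_mult_mat_vec[OF Y B z] assoc_mult_mat_vec[OF J Y z] by simp
  qed
  have Jw: "(J *\<^sub>v w) $ i = J $$ (i,i) * w $ i + (if i \<in> S then w $ Suc i else 0)"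
    if w: "w \<in> carrier_vec d" and i: "i < d" for w i
  proof -
    have "(J *\<^sub>v w) $ i = (\<Sum>j<d. J $$ (i,j) * w $ j)"
      using J w i by (auto simp: scalar_prod_def lessThan_atLeast0)
    also have "\<dots> = (\<Sum>j\<in>{i} \<union> (if i \<in> S then {Suc i} else {}). J $$ (i,j) * w $ j)"
    proof (rule sum.mono_neutral_right)
      show "\<forall>j\<in>{..<d} - ({i} \<union> (if i \<in> S then {Suc i} else {})). J $$ (i,j) * w $ j = 0"
      proof
        fix j assume j: "j \<in> {..<d} - ({i} \<union> (if i \<in> S then {Suc i} else {}))"
        then have "j < d" "j \<noteq> i" "j = Suc i \<Longrightarrow> i \<notin> S" by (auto split: if_splits)
        then have "J $$ (i,j) = 0" using Jent[OF i, of j] by (auto simp: S_def)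
        then show "J $$ (i,j) * w $ j = 0" by simp
      qed
    qed (use i in \<open>auto simp: S_def\<close>)
    also have "\<dots> = J $$ (i,i) * w $ i + (if i \<in> S then w $ Suc i else 0)"
      using Jent[OF i, of "Suc i"] by (auto simp: S_def)
    finally show ?thesis .
  qed
  \<comment> \<open>The weights \<open>(1/\<delta>)\<^sup>i\<close> turn the superdiagonal ones of \<open>J\<close> into \<open>\<delta>\<close>s.\<close>
  define M where "M = mat d d (\<lambda>(i,j). complex_of_real ((1/\<delta>)^i) * Y $$ (i,j))"
  have M: "M \<in> carrier_mat d d" unfolding M_def by simp
  have Mz: "(M *\<^sub>v z) $ i = complex_of_real ((1/\<delta>)^i) * (Y *\<^sub>v z) $ i"
    if "z \<in> carrier_vec d" "i < d" for z i
    using that Y unfolding M_def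
    by (auto simp: scalar_prod_def sum_distrib_left mult.assoc intro!: sum.cong)
  define X where "X = mat_adjoint M * M"
  have X: "X \<in> carrier_mat d d" unfolding X_def using M mat_adjoint_carrier[OF M] by auto
  have herm: "hermitian_mat X" unfolding X_def by (rule hermitian_Gram[OF M])
  define nrm where "nrm z = (\<Sum>i<d. (cmod ((M *\<^sub>v z) $ i))\<^sup>2)" for z
  have qX: "quad_form X z = complex_of_real (nrm z)" if "z \<in> carrier_vec d" for z
    unfolding X_def nrm_def by (rule quad_form_Gram[OF M that])
  have pos: "nrm z > 0" if z: "z \<in> carrier_vec d" and nz: "z \<noteq> 0\<^sub>v d" for z
  proof (rule ccontr)
    assume "\<not> nrm z > 0"
    then have "nrm z = 0" unfolding nrm_def by (meson sum_nonneg zero_le_power2 antisym_conv3 leD)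
    then have "\<forall>i<d. (M *\<^sub>v z) $ i = 0"
      unfolding nrm_def by (subst (asm) sum_nonneg_eq_0_iff) auto
    then have "Y *\<^sub>v z = 0\<^sub>v d" using Mz[OF z] Y z \<delta> by (intro eq_vecI) auto
    then have "P *\<^sub>v (Y *\<^sub>v z) = 0\<^sub>v d" using P by (auto intro!: eq_vecI)
    then have "z = 0\<^sub>v d" using assoc_mult_mat_vec[OF P Y z] PY z by simp
    with nz show False by simp
  qed
  have contr: "nrm (B *\<^sub>v z) \<le> r * nrm z" if z: "z \<in> carrier_vec d" for z
  proof -
    have Bz: "B *\<^sub>v z \<in> carrier_vec d" and Yz: "Y *\<^sub>v z \<in> carrier_vec d" using B Y z by auto
    have "complex_of_real \<delta> * complex_of_real ((1/\<delta>) ^ Suc i) = complex_of_real ((1/\<delta>) ^ i)" for i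
      using \<delta> by simp
    then have shift: "complex_of_real \<delta> * (complex_of_real ((1/\<delta>) ^ Suc i) * x)
        = complex_of_real ((1/\<delta>) ^ i) * x" for i x
      by (simp only: mult.assoc[symmetric])
    have "(M *\<^sub>v (B *\<^sub>v z)) $ i = J $$ (i,i) * (M *\<^sub>v z) $ i
        + (if i \<in> S then complex_of_real \<delta> * (M *\<^sub>v z) $ Suc i else 0)" if i: "i < d" for i
    proof (cases "i \<in> S")
      case True
      then have "Suc i < d" by (simp add: S_def)
      with True show ?thesis
        by (simp only: Mz[OF Bz i] Mz[OF z i] Mz[OF z] YBz[OF z] Jw[OF Yz i] shift if_True)
          (simp only: distrib_left mult.left_commute)
    next
      case False
      then show ?thesis
        by (simp add: Mz[OF Bz i] Mz[OF z i] YBz[OF z] Jw[OF Yz i])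
    qed
    then have "nrm (B *\<^sub>v z) = (\<Sum>i<d. (cmod (J $$ (i,i) * (M *\<^sub>v z) $ i
        + (if i \<in> S then complex_of_real \<delta> * (M *\<^sub>v z) $ Suc i else 0)))\<^sup>2)"
      unfolding nrm_def by simp
    also have "\<dots> \<le> r * nrm z"
      unfolding nrm_def
    proof (rule bidiagonal_contraction[OF \<delta>])
      fix i assume i: "i < d"
      show "(cmod (J $$ (i,i)))\<^sup>2 \<le> r" using Jent[OF i i] le by blast
    next
      fix i assume "i \<in> S"
      then have i: "i < d" "Suc i < d" "J $$ (i, Suc i) \<noteq> 0" by (auto simp: S_def)
      then show "Suc i < d \<and> J $$ (Suc i, Suc i) = J $$ (i,i)
          \<and> (1 + \<delta>) * (cmod (J $$ (i,i)))\<^sup>2 + (\<delta>\<^sup>2 + \<delta>) \<le> r"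
        using Jent[OF i(1,2)] small by blast
    qed
    finally show ?thesis .
  qed
  have "pos_def_mat X"
    using herm X pos qX by (auto simp: pos_def_mat_def less_complex_def)
  moreover have "pos_semidef_mat (complex_of_real r \<cdot>\<^sub>m X - mat_adjoint B * X * B)"
    unfolding pos_semidef_mat_def
  proof (intro conjI ballI)
    show "hermitian_mat (complex_of_real r \<cdot>\<^sub>m X - mat_adjoint B * X * B)"
      by (rule hermitian_Stein[OF X B herm])
    fix z :: "complex vec"
    assume "z \<in> carrier_vec (dim_row (complex_of_real r \<cdot>\<^sub>m X - mat_adjoint B * X * B))"
    then have z: "z \<in> carrier_vec d" using B mat_adjoint_carrier[OF B] by auto
    then have Bz: "B *\<^sub>v z \<in> carrier_vec d" using B by auto
    show "0 \<le> quad_form (complex_of_real r \<cdot>\<^sub>m X - mat_adjoint B * X * B) z"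
      unfolding quad_form_Stein[OF X B z] qX[OF z] qX[OF Bz]
      using contr[OF z] by (simp add: less_eq_complex_def)
  qed
  ultimately show ?thesis using X by blast
qed

text \<open>If \<open>B z = \<mu> z\<close>, then the forms of \<open>B\<^sup>* X B\<close> and \<open>X\<close> at \<open>z\<close> differ exactly by the factor
  \<open>\<bar>\<mu>\<bar>\<^sup>2\<close>.\<close>

lemma Stein_form_eigenvector:
  fixes X B :: "complex mat"
  assumes X: "X \<in> carrier_mat d d" and B: "B \<in> carrier_mat d d" and ev: "eigenvector B z \<mu>"
  shows "quad_form (complex_of_real ((cmod \<mu>)\<^sup>2) \<cdot>\<^sub>m X - mat_adjoint B * X * B) z = 0"
proof -
  have z: "z \<in> carrier_vec d" and Bz: "B *\<^sub>v z = \<mu> \<cdot>\<^sub>v z"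
    using ev B by (auto simp: eigenvector_def)
  show ?thesis
    unfolding quad_form_Stein[OF X B z] Bz quad_form_smult_vec[OF X z] by simp
qed

lemma jordan_nf_exists_complex:
  fixes B :: "complex mat"
  assumes B: "B \<in> carrier_mat d d"
  shows "\<exists>n_as. jordan_nf B n_as"
proof -
  obtain as where "char_poly B = (\<Prod>a\<leftarrow>as. [:- a, 1:])"
    using char_poly_factorized[OF B] by blast
  then show ?thesis by (rule jordan_nf_exists[OF B])
qed

text \<open>The characteristic polynomial contains a factor for the block; it vanishes at \<open>a\<close> because
  blocks of a Jordan normal form are nonempty.\<close>

lemma jordan_nf_eigenvalue:
  fixes B :: "complex mat"
  assumes B: "B \<in> carrier_mat d d" and jnf: "jordan_nf B n_as" and mem: "(n, a) \<in> set n_as"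
  shows "eigenvalue B a"
proof -
  have "n \<noteq> 0" using jnf mem by (force simp: jordan_nf_def)
  have "poly (char_poly B) a = (\<Prod>(m, b)\<leftarrow>n_as. (a - b) ^ m)"
    unfolding jordan_nf_char_poly[OF jnf] poly_prod_list
    by (rule arg_cong[of _ _ prod_list]) auto
  also have "\<dots> = 0"
    using mem \<open>n \<noteq> 0\<close> by (force simp: prod_list_zero_iff)
  finally show ?thesis using eigenvalue_root_char_poly[OF B] by simp
qed

theorem lemma6p4:
  fixes B :: "complex mat" and d :: nat and \<rho> :: real
  assumes "d \<ge> 1"
    and "B \<in> carrier_mat d d"
    and "\<forall>\<mu>. eigenvalue B \<mu> \<longrightarrow> cmod \<mu> < 1"
    and "\<rho> = spectral_radius B"
  shows "((\<forall>\<mu>. eigenvalue B \<mu> \<and> cmod \<mu> = \<rho> \<longrightarrow> semisimple_eigenvalue B \<mu>) \<longrightarrow>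
           (\<exists>X \<in> carrier_mat d d. pos_def_mat X \<and>
              pos_semidef_mat (complex_of_real (\<rho>\<^sup>2) \<cdot>\<^sub>m X - mat_adjoint B * X * B) \<and>
              (\<exists>z \<in> carrier_vec d. z \<noteq> 0\<^sub>v d \<and>
                 quad_form (complex_of_real (\<rho>\<^sup>2) \<cdot>\<^sub>m X - mat_adjoint B * X * B) z = 0)))
       \<and> ((\<exists>\<mu>. cmod \<mu> = \<rho> \<and> defective_eigenvalue B \<mu>) \<longrightarrow>
           (\<forall>\<epsilon>::real. \<epsilon> > 0 \<longrightarrow>
              (\<exists>X \<in> carrier_mat d d. pos_def_mat X \<and>
                 pos_semidef_mat (complex_of_real (\<rho>\<^sup>2 + \<epsilon>) \<cdot>\<^sub>m X - mat_adjoint B * X * B))))"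
proof -
  have "0 < d" using assms(1) by simp
  note B = assms(2) and rad = spectral_radius_mem_max[OF assms(2) \<open>0 < d\<close>, folded assms(4)]
  have le: "cmod \<mu> \<le> \<rho>" if "eigenvalue B \<mu>" for \<mu>
    using rad(2)[of "cmod \<mu>"] that by (auto simp: spectrum_def)
  obtain \<mu> z where \<mu>: "cmod \<mu> = \<rho>" "eigenvector B z \<mu>"
    using rad(1) by (auto simp: spectrum_def eigenvalue_def)
  obtain n_as where jnf: "jordan_nf B n_as" using jordan_nf_exists_complex[OF B] by blast
  have block: "eigenvalue B a" "(cmod a)\<^sup>2 \<le> \<rho>\<^sup>2" if "(n, a) \<in> set n_as" for n a
    using jordan_nf_eigenvalue[OF B jnf that] le by (auto intro: power_mono)
  show ?thesis
  proof (intro conjI impI allI)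
    assume semi: "\<forall>\<mu>. eigenvalue B \<mu> \<and> cmod \<mu> = \<rho> \<longrightarrow> semisimple_eigenvalue B \<mu>"
    have "(cmod a)\<^sup>2 < \<rho>\<^sup>2" if a: "(n, a) \<in> set n_as" and n: "n > 1" for n a
    proof -
      have "has_jordan_block B n a" using jnf a by (auto simp: has_jordan_block_def)
      then have "cmod a \<noteq> \<rho>"
        using semi block(1)[OF a] n by (auto simp: semisimple_eigenvalue_def)
      then show ?thesis using le[OF block(1)[OF a]] by (intro power_strict_mono) auto
    qed
    then obtain X where "X \<in> carrier_mat d d" "pos_def_mat X"
        "pos_semidef_mat (complex_of_real (\<rho>\<^sup>2) \<cdot>\<^sub>m X - mat_adjoint B * X * B)"
      using jordan_nf_Stein[OF B jnf, of "\<rho>\<^sup>2"] block(2) by blast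
    moreover have "z \<in> carrier_vec d" "z \<noteq> 0\<^sub>v d"
      using \<mu>(2) B by (auto simp: eigenvector_def)
    ultimately show "\<exists>X \<in> carrier_mat d d. pos_def_mat X \<and>
        pos_semidef_mat (complex_of_real (\<rho>\<^sup>2) \<cdot>\<^sub>m X - mat_adjoint B * X * B) \<and>
        (\<exists>z \<in> carrier_vec d. z \<noteq> 0\<^sub>v d \<and>
           quad_form (complex_of_real (\<rho>\<^sup>2) \<cdot>\<^sub>m X - mat_adjoint B * X * B) z = 0)"
      using Stein_form_eigenvector[OF _ B \<mu>(2)] unfolding \<mu>(1) by blast
  next
    fix \<epsilon> :: real assume "\<epsilon> > 0"
    then have "(cmod a)\<^sup>2 < \<rho>\<^sup>2 + \<epsilon>" if "(n, a) \<in> set n_as" for n a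
      using block(2)[OF that] by simp
    then show "\<exists>X \<in> carrier_mat d d. pos_def_mat X \<and>
        pos_semidef_mat (complex_of_real (\<rho>\<^sup>2 + \<epsilon>) \<cdot>\<^sub>m X - mat_adjoint B * X * B)"
      by (intro jordan_nf_Stein[OF B jnf]) (auto intro: less_imp_le)
  qed
qed

end
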